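(* For any integer $n\ge1$, the worst-case expected revenue rate $Z_r(n)=\inf_{\mathbb P\in\mathcal P}\mathbb E_{\mathbb P}[r_n(\tilde\rho)]$ is given by $$Z_r(n)=\frac{d}{2(m-a)}r_n(a)+\left(1-\frac{d}{2(m-a)}-\frac{d}{2(b-m)}\right)r_n(m)+\frac{d}{2(b-m)}r_n(b).$$
   Context: $R,C,\mu>0$ are fixed real constants. For an integer $n\ge0$, the revenue rate function $r_n:[0,\infty)\to\mathbb R$ is $$r_n(\rho)=(R\mu-Cn)\,\frac{\rho(1-\rho^n)}{1-\rho^{n+1}}\ (\rho\ne1),\qquad r_n(1)=(R\mu-Cn)\,\frac{n}{n+1}.$$ Real numbers $0\le a<b$, $m\in(a,b)$ and $d\in(0,\overline d)$ with $\overline d=\frac{2(m-a)(b-m)}{b-a}$ are given. The mean-absolute-deviation (MAD) ambiguity set is $$\mathcal P=\{\mathbb P \text{ a Borel probability measure on }[a,b]:\ \mathbb E_{\mathbb P}[\tilde\rho]=m,\ \mathbb E_{\mathbb P}[|\tilde\rho-m|]=d\}.$$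
   Formalization: The formal theorem adds the condition Cn ≤ Rμ; without it the claim is false, since for Cn > Rμ the rate r_n is strictly convex and the formula gives the supremum (e.g. R=μ=1, C=2, n=1, a=0, b=1, m=1/2, d=1/4). *)

theory Defs
  imports "HOL-Probability.Probability"
begin

definition revenue_rate :: "real \<Rightarrow> real \<Rightarrow> real \<Rightarrow> nat \<Rightarrow> real \<Rightarrow> real" where
  "revenue_rate R C \<mu> n \<rho> =
     (if \<rho> = 1 then (R * \<mu> - C * real n) * (real n / (real n + 1))
      else (R * \<mu> - C * real n) * (\<rho> * (1 - \<rho> ^ n) / (1 - \<rho> ^ (n + 1))))"

text \<open>Both integrands are bounded on the interval, so the Bochner integrals below are
  genuine expectations.\<close>

definition mad_ambiguity_set :: "real \<Rightarrow> real \<Rightarrow> real \<Rightarrow> real \<Rightarrow> real measure set" where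
  "mad_ambiguity_set a b m d =
     {P. prob_space P \<and> sets P = sets (restrict_space borel {a..b}) \<and>
         (\<integral>\<rho>. \<rho> \<partial>P) = m \<and> (\<integral>\<rho>. \<bar>\<rho> - m\<bar> \<partial>P) = d}"

text \<open>The infimum is taken in the extended reals, so that a finite value can only arise
  from a nonempty ambiguity set on which the expectations are bounded below.\<close>

definition worst_case_revenue ::
  "real \<Rightarrow> real \<Rightarrow> real \<Rightarrow> real \<Rightarrow> real \<Rightarrow> real \<Rightarrow> real \<Rightarrow> nat \<Rightarrow> ereal" where
  "worst_case_revenue R C \<mu> a b m d n =
     (INF P\<in>mad_ambiguity_set a b m d. ereal (\<integral>\<rho>. revenue_rate R C \<mu> n \<rho> \<partial>P))"

end

theory Submission
  imports Defs
begin

text \<open>Up to the nonnegative factor \<open>R * \<mu> - C * n\<close> the revenue rate is \<open>1 - w\<^sub>n\<close> with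
  \<open>w\<^sub>n(x) = 1 / (1 + x + \<dots> + x^n)\<close>, and \<open>w\<^sub>n\<close> satisfies the recursion
  \<open>w\<^sub>n\<^sub>+\<^sub>1 = w\<^sub>n / (x + w\<^sub>n)\<close>. The recursion preserves positivity, \<open>-1 \<le> w' \<le> 0\<close>,
  \<open>x + w \<ge> 1\<close> and \<open>w'' \<ge> 0\<close>, so the revenue rate is concave on the half line.
  A concave \<open>f\<close> dominates its piecewise linear interpolation at \<open>a\<close>, \<open>m\<close>, \<open>b\<close>,
  which has the form \<open>\<alpha> + \<beta> x + \<gamma> \<bar>x - m\<bar>\<close>; its expectation is therefore the same for every
  measure in the ambiguity set, and the bound is attained by a measure on these three points.\<close>

section \<open>Concavity of the revenue rate\<close>

text \<open>This is \<open>w\<^sub>n\<close>, the stationary probability that an M/M/1/n queue with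
  traffic intensity \<open>x\<close> is empty. The recursive form lets bounds and derivatives be
  obtained by induction on \<open>n\<close>.\<close>

fun idle_prob :: "nat \<Rightarrow> real \<Rightarrow> real" where
  "idle_prob 0 x = 1"
| "idle_prob (Suc n) x = idle_prob n x / (x + idle_prob n x)"

fun idle_prob' :: "nat \<Rightarrow> real \<Rightarrow> real" where
  "idle_prob' 0 x = 0"
| "idle_prob' (Suc n) x = (x * idle_prob' n x - idle_prob n x) / (x + idle_prob n x)^2"

text \<open>The quotient rule applied to the recursion for \<open>idle_prob'\<close>, with one
  common factor \<open>x + idle_prob n x\<close> cancelled.\<close>

fun idle_prob'' :: "nat \<Rightarrow> real \<Rightarrow> real" where
  "idle_prob'' 0 x = 0"
| "idle_prob'' (Suc n) x =
     (x * idle_prob'' n x * (x + idle_prob n x)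
       + 2 * (idle_prob n x - x * idle_prob' n x) * (1 + idle_prob' n x)) / (x + idle_prob n x)^3"

text \<open>The bounds have to be carried through one induction: the sign of the second derivative
  rests on \<open>w - x * w1 \<ge> 0\<close> and \<open>1 + w1 \<ge> 0\<close>, and the lower bound
  on the first derivative rests on \<open>x + w \<ge> 1\<close>.\<close>

lemma idle_prob_bounds:
  assumes "0 \<le> x"
  shows "0 < idle_prob n x \<and> 1 \<le> x + idle_prob n x \<and> -1 \<le> idle_prob' n x
    \<and> idle_prob' n x \<le> 0 \<and> 0 \<le> idle_prob'' n x"
proof (induction n)
  case 0
  then show ?case using assms by simp
next
  case (Suc n)
  define w w1 w2 where "w = idle_prob n x" and "w1 = idle_prob' n x" and "w2 = idle_prob'' n x"
  have w: "0 < w" "1 \<le> x + w" "-1 \<le> w1" "w1 \<le> 0" "0 \<le> w2"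
    using Suc by (auto simp: w_def w1_def w2_def)
  have xw1: "x * w1 \<le> 0" "- x \<le> x * w1"
    using assms w mult_left_mono[of "-1" w1 x] by (simp_all add: mult_nonneg_nonpos)
  have sq: "x + w \<le> (x + w)^2"
    using w(2) by (simp add: self_le_power)
  \<comment> \<open>Adding \<open>w\<close> and dividing by \<open>x + w\<close> turns this into the
    next bound.\<close>
  have "x * 1 \<le> x * (x + w)"
    using assms w(2) by (intro mult_left_mono) auto
  then have "1 \<le> x + w / (x + w)"
    using w(2) by (simp add: field_simps)
  \<comment> \<open>The numerator is at least \<open>-(x + w)\<close>, hence at least
    \<open>-(x + w)^2\<close>.\<close>
  moreover have "-1 \<le> (x * w1 - w) / (x + w)^2"
    using w(2) sq xw1 by (simp add: le_divide_eq)
  moreover have "(x * w1 - w) / (x + w)^2 \<le> 0"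
    using w xw1 by (intro divide_nonpos_nonneg) auto
  moreover have "0 \<le> 1 + w1" "0 \<le> w - x * w1"
    using w xw1 by linarith+
  then have "0 \<le> (x * w2 * (x + w) + 2 * (w - x * w1) * (1 + w1)) / (x + w)^3"
    using assms w by simp
  moreover have "0 < w / (x + w)"
    using w by simp
  ultimately show ?case
    by (simp add: w_def w1_def w2_def)
qed

lemma idle_prob_deriv:
  assumes "0 \<le> x"
  shows "(idle_prob n has_real_derivative idle_prob' n x) (at x)"
proof (induction n)
  case 0
  have "idle_prob 0 = (\<lambda>_. 1)" by auto
  then show ?case by simp
next
  case (Suc n)
  have eq: "idle_prob (Suc n) = (\<lambda>x. idle_prob n x / (x + idle_prob n x))" by auto
  have "x + idle_prob n x \<noteq> 0"
    using idle_prob_bounds[OF assms, of n] by linarith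
  then show ?case
    unfolding eq
    by (auto intro!: derivative_eq_intros Suc simp: field_simps power2_eq_square)
qed

lemma idle_prob'_deriv:
  assumes "0 \<le> x"
  shows "(idle_prob' n has_real_derivative idle_prob'' n x) (at x)"
proof (induction n)
  case 0
  have "idle_prob' 0 = (\<lambda>_. 0)" by auto
  then show ?case by simp
next
  case (Suc n)
  have eq: "idle_prob' (Suc n)
      = (\<lambda>x. (x * idle_prob' n x - idle_prob n x) / (x + idle_prob n x)^2)" by auto
  have nz: "x + idle_prob n x \<noteq> 0"
    using idle_prob_bounds[OF assms, of n] by linarith
  \<comment> \<open>The cancellation holds with \<open>s\<close> independent of \<open>w\<close>, so
    it reduces to a polynomial identity.\<close>
  have alg: "((w1 + x * w2 - w1) * s^2 - (x * w1 - w) * (2 * s * (1 + w1))) / (s^2 * s^2)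
      = (x * w2 * s + 2 * (w - x * w1) * (1 + w1)) / s^3"
    if "s \<noteq> 0" for s w w1 w2 :: real
    using that by (simp add: divide_simps) algebra
  have "((\<lambda>x. (x * idle_prob' n x - idle_prob n x) / (x + idle_prob n x)^2) has_real_derivative
      ((idle_prob' n x + x * idle_prob'' n x - idle_prob' n x) * (x + idle_prob n x)^2
        - (x * idle_prob' n x - idle_prob n x) * (2 * (x + idle_prob n x) * (1 + idle_prob' n x)))
      / ((x + idle_prob n x)^2 * (x + idle_prob n x)^2)) (at x)"
    using nz by (auto intro!: derivative_eq_intros Suc idle_prob_deriv[OF assms])
  then show ?case
    unfolding eq alg[OF nz] by simp
qed

lemma convex_on_idle_prob: "convex_on {0..} (idle_prob n)"
  using idle_prob_deriv idle_prob'_deriv idle_prob_bounds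
  by (intro f''_ge0_imp_convex[where f' = "idle_prob' n" and f'' = "idle_prob'' n"]) auto

lemma continuous_on_idle_prob: "continuous_on {0..} (idle_prob n)"
  by (intro continuous_at_imp_continuous_on ballI DERIV_isCont[OF idle_prob_deriv]) auto

text \<open>The geometric sums satisfy \<open>S\<^sub>n\<^sub>+\<^sub>1 = 1 + x * S\<^sub>n\<close>,
  and taking reciprocals gives exactly the recursion of \<open>idle_prob\<close>.\<close>

lemma idle_prob_closed_form:
  assumes "0 \<le> x"
  shows "idle_prob n x * (\<Sum>k\<le>n. x ^ k) = 1"
proof (induction n)
  case 0
  then show ?case by simp
next
  case (Suc n)
  define w S where "w = idle_prob n x" and "S = (\<Sum>k\<le>n. x ^ k)"
  have "(\<Sum>k\<le>Suc n. x ^ k) = 1 + x * S"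
    unfolding S_def by (subst sum.atMost_Suc_shift) (simp add: sum_distrib_left)
  moreover have "w * S = 1"
    using Suc by (simp add: w_def S_def)
  moreover have "x + w \<noteq> 0"
    using idle_prob_bounds[OF assms, of n] by (simp add: w_def)
  ultimately show ?case
    by (simp add: w_def[symmetric] field_simps)
qed

lemma revenue_rate_eq_idle_prob:
  assumes "0 \<le> x"
  shows "revenue_rate R C \<mu> n x = (R * \<mu> - C * real n) * (1 - idle_prob n x)"
proof (cases "x = 1")
  case True
  then have "idle_prob n x * (real n + 1) = 1"
    using idle_prob_closed_form[OF assms, of n] by (simp add: add.commute)
  then have "1 - idle_prob n x = real n / (real n + 1)"
    by (simp add: field_simps)
  then show ?thesis
    using True by (simp add: revenue_rate_def)
next
  case False
  have nz: "1 - x ^ (n + 1) \<noteq> 0"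
    using False assms power_eq_iff_eq_base[of "n + 1" x 1] by auto
  have "(1 - x) * (\<Sum>k\<le>n. x ^ k) = 1 - x ^ (n + 1)"
    using sum_gp_basic[of x n] by simp
  then have "idle_prob n x * (1 - x ^ (n + 1)) = (1 - x) * (idle_prob n x * (\<Sum>k\<le>n. x ^ k))"
    by (metis mult.left_commute)
  then have "idle_prob n x * (1 - x ^ (n + 1)) = 1 - x"
    by (simp add: idle_prob_closed_form[OF assms])
  then have "1 - idle_prob n x = x * (1 - x ^ n) / (1 - x ^ (n + 1))"
    using nz by (simp add: field_simps)
  then show ?thesis
    using False by (simp add: revenue_rate_def)
qed

text \<open>The sign hypothesis matters: a negative factor \<open>R * \<mu> - C * real n\<close>
  would make the revenue rate convex instead.\<close>

lemma concave_on_revenue_rate: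
  assumes "C * real n \<le> R * \<mu>"
  shows "concave_on {0..} (revenue_rate R C \<mu> n)"
proof -
  have "convex_on {0..} (\<lambda>x. (R * \<mu> - C * real n) * idle_prob n x + - (R * \<mu> - C * real n))"
    using assms convex_on_idle_prob
    by (intro convex_on_add convex_on_cmul) (auto simp: convex_on_const)
  then show ?thesis
    by (simp add: concave_on_def convex_on_def revenue_rate_eq_idle_prob algebra_simps)
qed

lemma continuous_on_revenue_rate: "continuous_on {0..} (revenue_rate R C \<mu> n)"
proof -
  have "continuous_on {0..} (\<lambda>x. (R * \<mu> - C * real n) * (1 - idle_prob n x))"
    by (intro continuous_intros continuous_on_idle_prob)
  then show ?thesis
    by (subst continuous_on_cong[OF refl revenue_rate_eq_idle_prob]) auto
qed

section \<open>The worst-case distribution for a concave function\<close>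

text \<open>Here \<open>s\<close> and \<open>t\<close> are the chord slopes on the two sides of
  \<open>m\<close>. Their average plus half their difference times the sign of \<open>x - m\<close>
  recovers each slope on its own side, so concavity on each half suffices.\<close>

lemma concave_on_ge_interpolation:
  fixes f :: "real \<Rightarrow> real"
  assumes f: "concave_on {a..b} f" and m: "a < m" "m < b" and x: "x \<in> {a..b}"
  defines "s \<equiv> (f m - f a) / (m - a)" and "t \<equiv> (f b - f m) / (b - m)"
  shows "f m + (s + t) / 2 * (x - m) + (t - s) / 2 * \<bar>x - m\<bar> \<le> f x"
proof (cases "x \<le> m")
  case True
  have "concave_on {a..m} f"
    using f m by (auto simp: concave_on_def intro: convex_on_subset)
  then have "s * (x - a) + f a \<le> f x"
    using True x m convex_onD_Icc'[of a m "\<lambda>x. - f x" x]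
    by (simp add: concave_on_def s_def field_simps)
  moreover have "s * (m - a) = f m - f a"
    using m by (simp add: s_def)
  ultimately show ?thesis
    using True by (simp add: abs_if field_simps)
next
  case False
  have "concave_on {m..b} f"
    using f m by (auto simp: concave_on_def intro: convex_on_subset)
  then have "t * (x - m) + f m \<le> f x"
    using False x m convex_onD_Icc'[of m b "\<lambda>x. - f x" x]
    by (simp add: concave_on_def t_def field_simps)
  then show ?thesis
    using False by (simp add: abs_if field_simps)
qed

lemma integrable_continuous_on_Icc:
  fixes f :: "real \<Rightarrow> real"
  assumes "prob_space P" and P: "sets P = sets (restrict_space borel {a..b})"
    and f: "continuous_on {a..b} f"
  shows "integrable P f"
proof -
  interpret prob_space P by fact
  have "space P = {a..b}"
    using sets_eq_imp_space_eq[OF P] by (simp add: space_restrict_space)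
  moreover have "bounded (f ` {a..b})"
    by (intro compact_imp_bounded compact_continuous_image f) auto
  then obtain B where "\<forall>x\<in>{a..b}. norm (f x) \<le> B"
    by (auto simp: bounded_iff)
  moreover have "f \<in> borel_measurable P"
    using borel_measurable_continuous_on_restrict[OF f] measurable_cong_sets[OF P refl] by blast
  ultimately show ?thesis
    by (intro integrable_const_bound[where B = B]) auto
qed

lemma three_point_measure:
  fixes a b m p q :: real
  assumes m: "a < m" "m < b" and pq: "0 \<le> p" "0 \<le> q" "p + q \<le> 1"
  obtains P where "prob_space P" and "sets P = sets (restrict_space borel {a..b})"
    and "\<And>f :: real \<Rightarrow> real. continuous_on {a..b} f \<Longrightarrow>
      (\<integral>x. f x \<partial>P) = p * f a + (1 - p - q) * f m + q * f b"
proof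
  define xs where "xs = [(a, p), (m, 1 - p - q), (b, q)]"
  \<comment> \<open>The pmf lives on all reals, so its mass is pushed into \<open>{a..b}\<close> by
    a map that fixes the three atoms; the value \<open>a\<close> outside is arbitrary.\<close>
  define g where "g x = (if x \<in> {a..b} then x else a)" for x
  define P where "P = distr (measure_pmf (pmf_of_list xs)) (restrict_space borel {a..b}) g"
  have xs: "pmf_of_list_wf xs"
    using pq by (intro pmf_of_list_wfI) (auto simp: xs_def)
  have g: "g \<in> measurable (measure_pmf (pmf_of_list xs)) (restrict_space borel {a..b})"
    using m by (auto simp: g_def space_restrict_space)
  show "prob_space P"
    unfolding P_def by (intro prob_space.prob_space_distr g) (rule measure_pmf.prob_space_axioms)
  show "sets P = sets (restrict_space borel {a..b})"
    by (simp add: P_def)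
  show "(\<integral>x. f x \<partial>P) = p * f a + (1 - p - q) * f m + q * f b"
    if f: "continuous_on {a..b} f" for f :: "real \<Rightarrow> real"
  proof -
    have "(\<integral>x. f x \<partial>P) = (\<integral>x. f (g x) \<partial>measure_pmf (pmf_of_list xs))"
      unfolding P_def
      by (intro integral_distr g borel_measurable_continuous_on_restrict f)
    also have "\<dots> = (\<Sum>x\<in>{a, m, b}. f (g x) * pmf (pmf_of_list xs) x)"
      using set_pmf_of_list[OF xs]
      by (intro integral_measure_pmf_real) (auto simp: xs_def)
    also have "\<dots> = p * f a + (1 - p - q) * f m + q * f b"
      using m by (simp add: pmf_pmf_of_list[OF xs]) (simp add: xs_def g_def)
    finally show ?thesis .
  qed
qed

lemma INF_mad_concave:
  fixes f :: "real \<Rightarrow> real"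
  assumes f: "concave_on {a..b} f" "continuous_on {a..b} f"
    and m: "a < m" "m < b" and d: "0 \<le> d" "d \<le> 2 * (m - a) * (b - m) / (b - a)"
  shows "(INF P\<in>mad_ambiguity_set a b m d. ereal (\<integral>x. f x \<partial>P)) =
    ereal (d / (2 * (m - a)) * f a + (1 - d / (2 * (m - a)) - d / (2 * (b - m))) * f m
      + d / (2 * (b - m)) * f b)" (is "_ = ereal ?V")
proof (rule antisym)
  \<comment> \<open>Mean \<open>m\<close> and deviation \<open>d\<close> force each side of
    \<open>m\<close> to contribute \<open>d / 2\<close>, which fixes the weights at \<open>a\<close>
    and \<open>b\<close>. The upper bound on \<open>d\<close> says that they sum to at most
    1.\<close>
  define p q where "p = d / (2 * (m - a))" and "q = d / (2 * (b - m))"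
  have "d * (b - a) \<le> 2 * (m - a) * (b - m)"
    using m d by (simp add: field_simps)
  then have "p + q \<le> 1"
    using m by (simp add: p_def q_def divide_simps) (simp add: algebra_simps)
  then obtain P where P: "prob_space P" "sets P = sets (restrict_space borel {a..b})"
    and int: "\<And>h :: real \<Rightarrow> real. continuous_on {a..b} h \<Longrightarrow>
      (\<integral>x. h x \<partial>P) = p * h a + (1 - p - q) * h m + q * h b"
    using three_point_measure[of a m b p q] m d(1) by (auto simp: p_def q_def)
  have pq: "p * (m - a) = d / 2" "q * (b - m) = d / 2"
    using m by (simp_all add: p_def q_def divide_simps)
  have "(\<integral>x. x \<partial>P) = m + q * (b - m) - p * (m - a)"
    using int[OF continuous_on_id] by (simp add: algebra_simps)
  then have "(\<integral>x. x \<partial>P) = m"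
    unfolding pq by simp
  moreover have "continuous_on {a..b} (\<lambda>x. \<bar>x - m\<bar>)"
    by (intro continuous_intros)
  then have "(\<integral>x. \<bar>x - m\<bar> \<partial>P) = p * (m - a) + q * (b - m)"
    using int[of "\<lambda>x. \<bar>x - m\<bar>"] m by simp
  then have "(\<integral>x. \<bar>x - m\<bar> \<partial>P) = d"
    unfolding pq by simp
  ultimately have "P \<in> mad_ambiguity_set a b m d"
    using P by (simp add: mad_ambiguity_set_def)
  then show "(INF P\<in>mad_ambiguity_set a b m d. ereal (\<integral>x. f x \<partial>P)) \<le> ereal ?V"
    by (rule INF_lower2) (simp add: int[OF f(2)] p_def q_def)
next
  define s t where "s = (f m - f a) / (m - a)" and "t = (f b - f m) / (b - m)"
  show "ereal ?V \<le> (INF P\<in>mad_ambiguity_set a b m d. ereal (\<integral>x. f x \<partial>P))"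
  proof (rule INF_greatest)
    fix P assume "P \<in> mad_ambiguity_set a b m d"
    then have P: "prob_space P" "sets P = sets (restrict_space borel {a..b})"
      and mean: "(\<integral>x. x \<partial>P) = m" and mad: "(\<integral>x. \<bar>x - m\<bar> \<partial>P) = d"
      by (auto simp: mad_ambiguity_set_def)
    interpret prob_space P by fact
    note integrable = integrable_continuous_on_Icc[OF P]
    have space: "space P = {a..b}"
      using sets_eq_imp_space_eq[OF P(2)] by (simp add: space_restrict_space)
    have i: "integrable P (\<lambda>x. x)" "integrable P (\<lambda>x. \<bar>x - m\<bar>)"
      by (auto intro!: integrable continuous_intros)
    \<comment> \<open>This is the expectation of the piecewise linear minorant: the term in
      \<open>x - m\<close> has mean zero and \<open>\<bar>x - m\<bar>\<close> has mean
      \<open>d\<close>.\<close>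
    have "?V = f m + (t - s) / 2 * d"
      using m by (simp add: s_def t_def divide_simps) (simp add: algebra_simps)
    also have "\<dots> = (\<integral>x. f m + (s + t) / 2 * (x - m) + (t - s) / 2 * \<bar>x - m\<bar> \<partial>P)"
      using i by (simp add: mean mad prob_space)
    also have "\<dots> \<le> (\<integral>x. f x \<partial>P)"
      using concave_on_ge_interpolation[OF f(1) m] i integrable[OF f(2)]
      by (intro integral_mono) (auto simp: s_def t_def space)
    finally show "ereal ?V \<le> ereal (\<integral>x. f x \<partial>P)"
      by simp
  qed
qed

theorem theorem3p8:
  fixes R C \<mu> a b m d :: real and n :: nat
  assumes "R > 0" and "C > 0" and "\<mu> > 0"
    and "0 \<le> a" and "a < b"
    and "m \<in> {a<..<b}"
    and "d \<in> {0<..<2 * (m - a) * (b - m) / (b - a)}"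
    and "n \<ge> 1"
    and nonneg_margin: "C * real n \<le> R * \<mu>"
  shows "worst_case_revenue R C \<mu> a b m d n =
    ereal (d / (2 * (m - a)) * revenue_rate R C \<mu> n a
      + (1 - d / (2 * (m - a)) - d / (2 * (b - m))) * revenue_rate R C \<mu> n m
      + d / (2 * (b - m)) * revenue_rate R C \<mu> n b)"
  unfolding worst_case_revenue_def
proof (rule INF_mad_concave)
  have sub: "{a..b} \<subseteq> {0..}"
    using \<open>0 \<le> a\<close> by auto
  show "concave_on {a..b} (revenue_rate R C \<mu> n)"
    using concave_on_revenue_rate[OF nonneg_margin] sub
    by (auto simp: concave_on_def intro: convex_on_subset)
  show "continuous_on {a..b} (revenue_rate R C \<mu> n)"
    by (rule continuous_on_subset[OF continuous_on_revenue_rate sub])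
qed (use assms in auto)

end
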